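(* Suppose that $\theta<\varkappa<\kappa$ are infinite cardinals with $\theta$ and $\kappa$ regular, and $J$ is a subnormal ideal over $\kappa$ extending $J^{\mathrm{bd}}[\kappa]$. If $\mathrm{ubd}(J,\varkappa)$ holds, then so does $\mathrm{onto}(J,\theta)$.
   Context: For an ideal $J$ over $\kappa$: $J^+:=\mathcal P(\kappa)\setminus J$, $J^*$ the dual filter. $J^{\mathrm{bd}}[\kappa]$ is the ideal of bounded subsets of $\kappa$. $J$ is subnormal if for every sequence $\langle E_\eta\mid\eta<\kappa\rangle$ of sets from $J^*$: (i) for every $B\in J^+$ there is $B'\subseteq B$ in $J^+$ such that $\beta\in E_\eta$ for all $\eta<\beta$ in $B'$; and (ii) for all $A,B\in J^+$ there are $A'\subseteq A$, $B'\subseteq B$ in $J^+$ such that $\beta\in E_\eta$ for all $\eta\in A'$, $\beta\in B'$ with $\eta<\beta$. Colourings are on pairs $\alpha<\beta<\kappa$, upper-regressive means $c(\alpha,\beta)<\beta$, $\{\eta\}\circledast B:=\{(\eta,\beta)\mid\beta\in B,\ \eta<\beta\}$. $\mathrm{ubd}(J,\varkappa)$: there is an upper-regressive $c:[\kappa]^2\to\varkappa$ such that for every $B\in J^+$ some $\eta<\kappa$ has $\mathrm{otp}(c[\{\eta\}\circledast B])=\varkappa$. $\mathrm{onto}(J,\theta)$: there is $c:[\kappa]^2\to\theta$ such that for every $B\in J^+$ some $\eta<\kappa$ has $c[\{\eta\}\circledast B]=\theta$. *)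

theory Defs
  imports Main
begin

unbundle cardinal_syntax

text \<open>
  Ordinals are elements of an arbitrary wellordered type. As with von Neumann ordinals, an
  ordinal \<open>\<alpha>\<close> also stands for the set \<open>{..<\<alpha>}\<close> of its predecessors.
\<close>

definition ord_on :: "'a::wellorder set \<Rightarrow> 'a rel" where
  "ord_on X = {(x, y). x \<in> X \<and> y \<in> X \<and> x \<le> y}"

definition infinite_cardinal :: "'a::wellorder \<Rightarrow> bool" where
  "infinite_cardinal \<kappa> \<longleftrightarrow> Card_order (ord_on {..<\<kappa>}) \<and> infinite {..<\<kappa>}"

definition regular_cardinal :: "'a::wellorder \<Rightarrow> bool" where
  "regular_cardinal \<kappa> \<longleftrightarrow> infinite_cardinal \<kappa> \<and> regularCard (ord_on {..<\<kappa>})"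

definition has_otp :: "'a::wellorder set \<Rightarrow> 'a \<Rightarrow> bool" where
  "has_otp X \<alpha> \<longleftrightarrow> ord_on X =o ord_on {..<\<alpha>}"

text \<open>
  Properness of \<open>J\<close> is not required: for an improper ideal there are no positive sets.
\<close>

definition ideal_over :: "'a::wellorder \<Rightarrow> 'a set set \<Rightarrow> bool" where
  "ideal_over \<kappa> J \<longleftrightarrow>
     J \<subseteq> Pow {..<\<kappa>} \<and> {} \<in> J \<and>
     (\<forall>A\<in>J. \<forall>B. B \<subseteq> A \<longrightarrow> B \<in> J) \<and>
     (\<forall>A\<in>J. \<forall>B\<in>J. A \<union> B \<in> J)"

definition bounded_ideal :: "'a::wellorder \<Rightarrow> 'a set set" where
  "bounded_ideal \<kappa> = {A. A \<subseteq> {..<\<kappa>} \<and> (\<exists>\<alpha><\<kappa>. A \<subseteq> {..<\<alpha>})}"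

definition positive :: "'a::wellorder \<Rightarrow> 'a set set \<Rightarrow> 'a set set" where
  "positive \<kappa> J = Pow {..<\<kappa>} - J"

definition dual_filter :: "'a::wellorder \<Rightarrow> 'a set set \<Rightarrow> 'a set set" where
  "dual_filter \<kappa> J = {{..<\<kappa>} - A | A. A \<in> J}"

definition subnormal :: "'a::wellorder \<Rightarrow> 'a set set \<Rightarrow> bool" where
  "subnormal \<kappa> J \<longleftrightarrow>
     (\<forall>E :: 'a \<Rightarrow> 'a set. (\<forall>\<eta><\<kappa>. E \<eta> \<in> dual_filter \<kappa> J) \<longrightarrow>
       (\<forall>B \<in> positive \<kappa> J. \<exists>B' \<in> positive \<kappa> J. B' \<subseteq> B \<and>
          (\<forall>\<eta>\<in>B'. \<forall>\<beta>\<in>B'. \<eta> < \<beta> \<longrightarrow> \<beta> \<in> E \<eta>)) \<and>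
       (\<forall>A \<in> positive \<kappa> J. \<forall>B \<in> positive \<kappa> J.
          \<exists>A' \<in> positive \<kappa> J. \<exists>B' \<in> positive \<kappa> J. A' \<subseteq> A \<and> B' \<subseteq> B \<and>
          (\<forall>\<eta>\<in>A'. \<forall>\<beta>\<in>B'. \<eta> < \<beta> \<longrightarrow> \<beta> \<in> E \<eta>)))"

definition pairs :: "'a::wellorder \<Rightarrow> ('a \<times> 'a) set" where
  "pairs \<kappa> = {(\<alpha>, \<beta>). \<alpha> < \<beta> \<and> \<beta> < \<kappa>}"

definition upper_regressive :: "'a::wellorder \<Rightarrow> ('a \<times> 'a \<Rightarrow> 'a) \<Rightarrow> bool" where
  "upper_regressive \<kappa> c \<longleftrightarrow> (\<forall>(\<alpha>, \<beta>) \<in> pairs \<kappa>. c (\<alpha>, \<beta>) < \<beta>)"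

definition circledast :: "'a::wellorder set \<Rightarrow> 'a set \<Rightarrow> ('a \<times> 'a) set"  (infixr \<open>\<circledast>\<close> 80) where
  "A \<circledast> B = {(\<eta>, \<beta>). \<eta> \<in> A \<and> \<beta> \<in> B \<and> \<eta> < \<beta>}"

definition ubd :: "'a::wellorder \<Rightarrow> 'a set set \<Rightarrow> 'a \<Rightarrow> bool" where
  "ubd \<kappa> J \<mu> \<longleftrightarrow>
     (\<exists>c. c ` pairs \<kappa> \<subseteq> {..<\<mu>} \<and> upper_regressive \<kappa> c \<and>
       (\<forall>B \<in> positive \<kappa> J. \<exists>\<eta><\<kappa>. has_otp (c ` ({\<eta>} \<circledast> B)) \<mu>))"

definition onto :: "'a::wellorder \<Rightarrow> 'a set set \<Rightarrow> 'a \<Rightarrow> bool" where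
  "onto \<kappa> J \<theta> \<longleftrightarrow>
     (\<exists>c. c ` pairs \<kappa> \<subseteq> {..<\<theta>} \<and>
       (\<forall>B \<in> positive \<kappa> J. \<exists>\<eta><\<kappa>. c ` ({\<eta>} \<circledast> B) = {..<\<theta>}))"

end

theory Submission
  imports Defs
begin

text \<open>
  Subnormality makes \<open>J\<close> \<open>\<kappa>\<close>-complete, so a witness \<open>c\<close> of \<open>ubd \<kappa> J \<mu>\<close> satisfies more: every
  positive \<open>B\<close> has an \<open>\<eta>\<close> for which more than \<open>\<theta>\<close> colours \<open>\<tau>\<close> have a positive fibre
  \<open>{\<beta> \<in> B. c (\<eta>, \<beta>) = \<tau>}\<close>. It remains to find at most \<open>\<kappa>\<close> maps \<open>\<mu> \<rightarrow> \<theta>\<close> such that every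
  \<open>X \<subseteq> \<mu>\<close> with more than \<open>\<theta>\<close> elements is sent onto \<open>\<theta>\<close> by one of them, and to compose these
  with \<open>c\<close>. Cutting \<open>X\<close> off at the first \<open>\<rho>\<close> below which it has more than \<open>\<theta>\<close> elements
  reduces this to sets \<open>Y\<close> of full size in a chain \<open>Q\<close> of order type \<open>\<theta>\<^sup>+\<close>.

  There, fix injections \<open>e \<beta>\<close> of the elements of \<open>Q\<close> up to \<open>\<beta>\<close> into \<open>\<theta>\<close>, and a map \<open>s\<close> to \<open>\<theta>\<close>
  all of whose fibres are stationary in the points of cofinality \<open>\<theta>\<close>. The map with index
  \<open>(\<xi>, \<alpha>)\<close> sends \<open>\<beta>\<close> to \<open>s \<delta>\<close>, where \<open>\<delta> \<in> (\<alpha>, \<beta>]\<close> is least with \<open>e \<beta> \<delta> \<le> e \<beta> \<xi>\<close>. If every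
  index misses a colour on \<open>Y\<close>, then by counting one colour \<open>i\<close> is missed at \<open>\<theta>\<^sup>+\<close> many \<open>\<alpha>\<close> for
  each of \<open>\<theta>\<^sup>+\<close> many \<open>\<xi>\<close>. Take \<open>\<delta>\<close> with \<open>s \<delta> = i\<close> that is closed under this data, and any
  \<open>\<beta> \<in> Y\<close> above \<open>\<delta>\<close>. Some such \<open>\<xi> < \<delta>\<close> has \<open>e \<beta> \<delta> \<le> e \<beta> \<xi>\<close>, and fewer than \<open>\<theta>\<close> points
  \<open>y < \<delta>\<close> satisfy \<open>e \<beta> y \<le> e \<beta> \<xi>\<close>, so all of them lie below some \<open>\<alpha> < \<delta>\<close> missing \<open>i\<close>. The
  index \<open>(\<xi>, \<alpha>)\<close> then finds \<open>\<delta>\<close>, and \<open>i\<close> is not missed after all.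
\<close>

section \<open>Adding finitely many elements below an infinite cardinal\<close>

lemma card_of_insert_ordLeq:
  assumes "infinite C" "|A| \<le>o |C|"
  shows "|insert a A| \<le>o |C|"
proof -
  have "|{a} \<union> A| \<le>o |C|"
  proof (rule card_of_Un_ordLeq_infinite_Field)
    show "|{a}| \<le>o |C|" using assms(1) by (intro card_of_singl_ordLeq) auto
  qed (use assms card_of_Card_order[of C] in \<open>simp_all add: Field_card_of\<close>)
  then show ?thesis by simp
qed

lemma finite_ordLess_card_of:
  assumes "infinite C" "finite A"
  shows "|A| <o |C|"
proof (rule ccontr)
  assume "\<not> |A| <o |C|"
  then have "|C| \<le>o |A|" using not_ordLess_iff_ordLeq[OF card_of_Well_order card_of_Well_order] by blast
  then show False using card_of_ordLeq_finite assms by blast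
qed

lemma card_of_insert_ordLess:
  assumes "infinite C" "|A| <o |C|"
  shows "|insert a A| <o |C|"
  using card_of_Un_ordLess_infinite[OF assms(1) finite_ordLess_card_of[OF assms(1)] assms(2), of "{a}"]
  by simp

section \<open>Combinatorics of a chain of order type \<open>\<theta>\<^sup>+\<close>\<close>

text \<open>\<open>large\<close> and \<open>initial\<close> together give \<open>Q\<close> order
  type \<open>\<theta>\<^sup>+\<close>, while \<open>below\<close> and \<open>union\<close> express
  that \<theta> is a regular cardinal. \<open>Q\<close> is a set and not an ordinal because it will
  be a cofinal subset of some \<rho>.\<close>

locale successor_chain =
  fixes Q :: "'a::wellorder set" and \<theta> :: "'a"
  assumes inf: "infinite {..<\<theta>}"
    and below: "j < \<theta> \<Longrightarrow> |{..j}| <o |{..<\<theta>}|"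
    and union: "\<And>(I :: 'a set) A :: 'a \<Rightarrow> 'a set.
          |I| <o |{..<\<theta>}| \<Longrightarrow> (\<And>i. i \<in> I \<Longrightarrow> |A i| <o |{..<\<theta>}| ) \<Longrightarrow> |\<Union>i\<in>I. A i| <o |{..<\<theta>}|"
    and large: "\<not> |Q| \<le>o |{..<\<theta>}|"
    and initial: "x \<in> Q \<Longrightarrow> |{y \<in> Q. y < x}| \<le>o |{..<\<theta>}|"
begin

abbreviation small :: "'b set \<Rightarrow> bool" where
  "small W \<equiv> |W| \<le>o |{..<\<theta>}|"

abbreviation tiny :: "'b set \<Rightarrow> bool" where
  "tiny W \<equiv> |W| <o |{..<\<theta>}|"

lemma not_tiny: "\<not> tiny W \<longleftrightarrow> |{..<\<theta>}| \<le>o |W|"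
  by (rule not_ordLess_iff_ordLeq[OF card_of_Well_order card_of_Well_order])

lemma not_small:
  assumes "\<not> small W"
  obtains t where "inj_on t {..<\<theta>}" "t ` {..<\<theta>} \<subseteq> W"
proof -
  have "|{..<\<theta>}| \<le>o |W|"
    using assms ordLeq_total[OF card_of_Well_order card_of_Well_order, of "{..<\<theta>}" W] by blast
  from card_of_ordLeq[THEN iffD2, OF this] that show thesis by blast
qed

lemma tiny_mono: "tiny W \<Longrightarrow> V \<subseteq> W \<Longrightarrow> tiny V"
  by (rule ordLeq_ordLess_trans[OF card_of_mono1])

lemma small_mono: "small W \<Longrightarrow> V \<subseteq> W \<Longrightarrow> small V"
  by (rule ordLeq_transitive[OF card_of_mono1])

lemma tiny_finite: "finite W \<Longrightarrow> tiny W"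
  by (rule finite_ordLess_card_of[OF inf])

lemma tiny_insert: "tiny W \<Longrightarrow> tiny (insert a W)"
  by (rule card_of_insert_ordLess[OF inf])

lemma small_image: "small W \<Longrightarrow> small (f ` W)"
  by (rule ordLeq_transitive[OF card_of_image])

lemma small_refl: "small {..<\<theta>}"
  by (rule ordIso_imp_ordLeq[OF card_of_refl])

lemma small_UN: "small I \<Longrightarrow> (\<And>i. i \<in> I \<Longrightarrow> small (A i)) \<Longrightarrow> small (\<Union>i\<in>I. A i)"
  using card_of_UNION_ordLeq_infinite[OF inf] by blast

lemma small_insert: "small W \<Longrightarrow> small (insert a W)"
  by (rule card_of_insert_ordLeq[OF inf])

lemma initial_le:
  assumes "x \<in> Q"
  shows "small {y \<in> Q. y \<le> x}"
proof -
  have "{y \<in> Q. y \<le> x} = insert x {y \<in> Q. y < x}" using assms by auto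
  then show ?thesis using small_insert initial[OF assms] by simp
qed

text \<open>This is the regularity of \<open>\<theta>\<^sup>+\<close>: otherwise at most \<theta>
  initial segments, each of size at most \<theta>, would cover \<open>Q\<close>.\<close>

lemma bounded:
  assumes "W \<subseteq> Q" "small W"
  shows "\<exists>q\<in>Q. \<forall>w\<in>W. w < q"
proof (rule ccontr)
  assume "\<not> ?thesis"
  then have "Q \<subseteq> (\<Union>w\<in>W. {y \<in> Q. y \<le> w})" by (force simp: not_less)
  moreover have "small (\<Union>w\<in>W. {y \<in> Q. y \<le> w})"
    using assms initial_le by (intro small_UN) auto
  ultimately show False using large small_mono by blast
qed

lemma unbounded:
  assumes "Y \<subseteq> Q" "\<not> small Y" "q \<in> Q"
  shows "\<exists>y\<in>Y. q < y"
proof (rule ccontr)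
  assume "\<not> ?thesis"
  then have "Y \<subseteq> {y \<in> Q. y \<le> q}" using assms(1) by (auto simp: not_less)
  then show False using initial_le[OF assms(3)] assms(2) small_mono by blast
qed

text \<open>Sets of closed points replace clubs. The least point of \<open>Q\<close> is closed
  vacuously; \<open>wide\<close> excludes it, through the empty \<open>W\<close>.\<close>

definition closed_under :: "('a \<Rightarrow> 'a) \<Rightarrow> 'a \<Rightarrow> bool" where
  "closed_under F \<delta> \<longleftrightarrow> \<delta> \<in> Q \<and> (\<forall>x\<in>Q. x < \<delta> \<longrightarrow> F x < \<delta>)"

text \<open>Cofinality at least \<open>\<theta>\<close>.\<close>

definition wide :: "'a \<Rightarrow> bool" where
  "wide \<delta> \<longleftrightarrow> (\<forall>W. W \<subseteq> {y \<in> Q. y < \<delta>} \<and> tiny W \<longrightarrow> (\<exists>b\<in>Q. b < \<delta> \<and> (\<forall>w\<in>W. w < b)))"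

lemma closed_underD: "closed_under F \<delta> \<Longrightarrow> x \<in> Q \<Longrightarrow> x < \<delta> \<Longrightarrow> F x < \<delta>"
  by (simp add: closed_under_def)

lemma wideD:
  assumes "wide \<delta>" "W \<subseteq> {y \<in> Q. y < \<delta>}" "tiny W"
  obtains b where "b \<in> Q" "b < \<delta>" "\<And>w. w \<in> W \<Longrightarrow> w < b"
proof -
  have "\<exists>b\<in>Q. b < \<delta> \<and> (\<forall>w\<in>W. w < b)"
    by (rule assms(1)[unfolded wide_def, THEN spec, THEN mp]) (use assms in simp)
  then show thesis using that by blast
qed

text \<open>Iterate \<omega> times, from \<open>q\<close>, a function \<open>G\<close> dominating
  \<open>F\<close> on initial segments; the least upper bound of the iterates is closed.\<close>

lemma closed_above:
  assumes F: "\<And>x. x \<in> Q \<Longrightarrow> F x \<in> Q" and q: "q \<in> Q"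
  shows "\<exists>\<delta>. q < \<delta> \<and> closed_under F \<delta>"
proof -
  have "\<exists>z\<in>Q. x < z \<and> (\<forall>y\<in>Q. y \<le> x \<longrightarrow> F y < z)" if "x \<in> Q" for x
  proof -
    have "small (insert x (F ` {y \<in> Q. y \<le> x}))"
      by (intro small_insert small_image initial_le that)
    then show ?thesis using bounded[of "insert x (F ` {y \<in> Q. y \<le> x})"] F that by auto
  qed
  then obtain G where G: "\<And>x. x \<in> Q \<Longrightarrow> G x \<in> Q \<and> x < G x \<and> (\<forall>y\<in>Q. y \<le> x \<longrightarrow> F y < G x)"
    by metis
  define w where "w n = (G ^^ n) q" for n
  have w: "w n \<in> Q" for n by (induction n) (auto simp: w_def q G)
  have "small (range w)"
    using inf by (intro small_image) (simp add: infinite_iff_card_of_nat)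
  then have ex: "\<exists>d. d \<in> Q \<and> (\<forall>n. w n < d)" using bounded[of "range w"] w by auto
  define \<delta> where "\<delta> = (LEAST d. d \<in> Q \<and> (\<forall>n. w n < d))"
  have \<delta>: "\<delta> \<in> Q" "w n < \<delta>" for n using LeastI_ex[OF ex] by (auto simp: \<delta>_def)
  have "F x < \<delta>" if x: "x \<in> Q" "x < \<delta>" for x
  proof -
    obtain n where "x \<le> w n" using x not_less_Least[of x] by (fastforce simp: \<delta>_def not_less)
    then have "F x < w (Suc n)" using G[OF w[of n]] x by (simp add: w_def)
    then show ?thesis using \<delta>(2) less_trans by blast
  qed
  moreover have "q < \<delta>" using \<delta>(2)[of 0] by (simp add: w_def)
  ultimately show ?thesis using \<delta> by (auto simp: closed_under_def)
qed

lemma closed_wide: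
  assumes F: "\<And>x. x \<in> Q \<Longrightarrow> F x \<in> Q"
  shows "\<exists>\<delta>. closed_under F \<delta> \<and> wide \<delta>"
proof -
  \<comment> \<open>The supremum of the first \<open>\<theta>\<close> closed points.\<close>
  define Z where "Z = {z. closed_under F z}"
  have ZQ: "Z \<subseteq> Q" by (auto simp: Z_def closed_under_def)
  have "\<not> small Z"
  proof
    assume "small Z"
    then obtain q where "q \<in> Q" "\<forall>z\<in>Z. z < q" using bounded[OF ZQ] by auto
    then show False using closed_above[of F q] F by (force simp: Z_def)
  qed
  then obtain t where t: "inj_on t {..<\<theta>}" "t ` {..<\<theta>} \<subseteq> Z" by (rule not_small)
  obtain q where q: "q \<in> Q" "\<forall>z\<in>t ` {..<\<theta>}. z < q"
    using bounded[of "t ` {..<\<theta>}"] small_image[OF small_refl] t(2) ZQ by blast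
  have "|{..<\<theta>}| \<le>o |{z \<in> Z. z < q}|"
    by (rule card_of_ordLeq[THEN iffD1]) (use t q in auto)
  then have "\<not> tiny {z \<in> Z. z < q}" using not_tiny by blast
  then have ex: "\<exists>d. d \<in> Q \<and> \<not> tiny {z \<in> Z. z < d}" using q by blast
  define \<delta> where "\<delta> = (LEAST d. d \<in> Q \<and> \<not> tiny {z \<in> Z. z < d})"
  have \<delta>: "\<delta> \<in> Q" "\<not> tiny {z \<in> Z. z < \<delta>}" using LeastI_ex[OF ex] by (auto simp: \<delta>_def)
  have least: "tiny {z \<in> Z. z < d}" if "d \<in> Q" "d < \<delta>" for d
    using that not_less_Least[of d] by (fastforce simp: \<delta>_def)
  \<comment> \<open>Otherwise fewer than \<theta> points \<open>w\<close> would cover the closed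
    points below \<delta> by pieces that are tiny by minimality of \<delta>; regularity of \<theta>
    forbids this. Both closure and wideness of \<delta> follow.\<close>
  have lim: "\<exists>z\<in>Z. z < \<delta> \<and> (\<forall>w\<in>W. w < z)" if W: "W \<subseteq> {y \<in> Q. y < \<delta>}" "tiny W" for W
  proof (rule ccontr)
    assume "\<not> ?thesis"
    then have "{z \<in> Z. z < \<delta>} \<subseteq> (\<Union>w\<in>W. insert w {z \<in> Z. z < w})"
      by (auto simp: not_less le_less)
    moreover have "tiny (\<Union>w\<in>W. insert w {z \<in> Z. z < w})"
      using W least by (intro union tiny_insert) auto
    ultimately show False using \<delta>(2) tiny_mono by blast
  qed
  have "F x < \<delta>" if x: "x \<in> Q" "x < \<delta>" for x
  proof -
    obtain z where "z \<in> Z" "z < \<delta>" "x < z" using lim[of "{x}"] x tiny_finite[of "{x}"] by auto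
    then show ?thesis using x by (auto simp: Z_def closed_under_def)
  qed
  then have "closed_under F \<delta>" using \<delta> by (auto simp: closed_under_def)
  moreover have "wide \<delta>" using lim ZQ unfolding wide_def by (meson subsetD)
  ultimately show ?thesis by blast
qed

text \<open>Stationarity in terms of closed points: intersecting \<theta> clubs becomes bounding
  \<theta> functions at each point.\<close>

definition stat :: "'a set \<Rightarrow> bool" where
  "stat Z \<longleftrightarrow> (\<forall>F. (\<forall>x\<in>Q. F x \<in> Q) \<longrightarrow> (\<exists>\<delta>\<in>Z. closed_under F \<delta>))"

text \<open>Pigeonhole principle: \<theta> many small fibres have a small union.\<close>

lemma large_fibre:
  assumes "P \<subseteq> Q" "\<not> small P" "\<And>x. x \<in> P \<Longrightarrow> h x \<in> {..<\<theta>}"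
  shows "\<exists>i<\<theta>. \<not> small {x \<in> P. h x = i}"
proof (rule ccontr)
  assume "\<not> ?thesis"
  then have "small (\<Union>i\<in>{..<\<theta>}. {x \<in> P. h x = i})"
    by (intro small_UN small_refl) auto
  moreover have "P \<subseteq> (\<Union>i\<in>{..<\<theta>}. {x \<in> P. h x = i})" using assms(3) by auto
  ultimately show False using assms(2) small_mono by blast
qed

lemma enumerations:
  obtains e where "\<And>\<beta>. \<beta> \<in> Q \<Longrightarrow> inj_on (e \<beta>) {y \<in> Q. y \<le> \<beta>}"
    "\<And>\<beta> y. \<beta> \<in> Q \<Longrightarrow> y \<in> Q \<Longrightarrow> y \<le> \<beta> \<Longrightarrow> e \<beta> y < \<theta>"
proof -
  have "\<forall>\<beta>\<in>Q. \<exists>f. inj_on f {y \<in> Q. y \<le> \<beta>} \<and> f ` {y \<in> Q. y \<le> \<beta>} \<subseteq> {..<\<theta>}"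
    using initial_le by (simp add: card_of_ordLeq)
  then obtain e where "\<forall>\<beta>\<in>Q. inj_on (e \<beta>) {y \<in> Q. y \<le> \<beta>} \<and> e \<beta> ` {y \<in> Q. y \<le> \<beta>} \<subseteq> {..<\<theta>}"
    by (auto dest: bchoice)
  then show thesis by (intro that[of e]) auto
qed

text \<open>
  An Ulam matrix: for fixed \<open>i\<close> the sets \<open>S \<epsilon> i\<close> are pairwise disjoint because \<open>e \<delta>\<close> is injective,
  and some \<open>i\<close> makes more than \<open>\<theta>\<close> of them stationary.
\<close>

lemma stationary_partition:
  obtains s where "\<And>\<delta>. s \<delta> < \<theta>" "\<And>t. t < \<theta> \<Longrightarrow> stat {\<delta>. wide \<delta> \<and> s \<delta> = t}"
proof -
  obtain e where e: "\<And>\<beta>. \<beta> \<in> Q \<Longrightarrow> inj_on (e \<beta>) {y \<in> Q. y \<le> \<beta>}"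
    "\<And>\<beta> y. \<beta> \<in> Q \<Longrightarrow> y \<in> Q \<Longrightarrow> y \<le> \<beta> \<Longrightarrow> e \<beta> y < \<theta>"
    using enumerations by blast
  define S where "S \<epsilon> i = {\<delta> \<in> Q. wide \<delta> \<and> \<epsilon> < \<delta> \<and> e \<delta> \<epsilon> = i}" for \<epsilon> i
  have "\<exists>i<\<theta>. stat (S \<epsilon> i)" if \<epsilon>: "\<epsilon> \<in> Q" for \<epsilon>
  proof (rule ccontr)
    assume "\<not> ?thesis"
    then have "\<forall>i. \<exists>F. i < \<theta> \<longrightarrow> (\<forall>x\<in>Q. F x \<in> Q) \<and> (\<forall>\<delta>\<in>S \<epsilon> i. \<not> closed_under F \<delta>)"
      unfolding stat_def by blast
    from choice[OF this] obtain F where F: "\<And>i x. i < \<theta> \<Longrightarrow> x \<in> Q \<Longrightarrow> F i x \<in> Q"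
      "\<And>i \<delta>. i < \<theta> \<Longrightarrow> \<delta> \<in> S \<epsilon> i \<Longrightarrow> \<not> closed_under (F i) \<delta>" by blast
    have "\<exists>z\<in>Q. \<epsilon> < z \<and> (\<forall>i<\<theta>. F i x < z)" if "x \<in> Q" for x
    proof -
      have "small (insert \<epsilon> ((\<lambda>i. F i x) ` {..<\<theta>}))"
        by (intro small_insert small_image small_refl)
      moreover have "insert \<epsilon> ((\<lambda>i. F i x) ` {..<\<theta>}) \<subseteq> Q" using F(1) that \<epsilon> by auto
      ultimately show ?thesis using bounded[of "insert \<epsilon> ((\<lambda>i. F i x) ` {..<\<theta>})"] by auto
    qed
    \<comment> \<open>\<open>G\<close> dominates \<epsilon> and all the \<open>F i\<close>, so a
      wide point closed under \<open>G\<close> lies above \<epsilon> and is closed under every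
      \<open>F i\<close>; yet it belongs to some \<open>S \<epsilon> i\<close>.\<close>
    then obtain G where G: "\<And>x. x \<in> Q \<Longrightarrow> G x \<in> Q \<and> \<epsilon> < G x \<and> (\<forall>i<\<theta>. F i x < G x)" by metis
    then obtain \<delta> where \<delta>: "closed_under G \<delta>" "wide \<delta>" using closed_wide[of G] by blast
    obtain b where b: "b \<in> Q" "b < \<delta>" by (rule wideD[OF \<delta>(2), of "{}"]) (auto simp: tiny_finite)
    have "\<epsilon> < G b" using G b(1) by blast
    then have "\<epsilon> < \<delta>" using closed_underD[OF \<delta>(1) b] by (rule less_trans)
    moreover have "\<delta> \<in> Q" using \<delta>(1) by (simp add: closed_under_def)
    ultimately have "\<delta> \<in> S \<epsilon> (e \<delta> \<epsilon>)" "e \<delta> \<epsilon> < \<theta>" using \<delta> e(2) \<epsilon> by (auto simp: S_def)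
    moreover have "closed_under (F i) \<delta>" if "i < \<theta>" for i
      unfolding closed_under_def
    proof (intro conjI ballI impI)
      show "\<delta> \<in> Q" by fact
      fix x assume x: "x \<in> Q" "x < \<delta>"
      have "F i x < G x" using G x(1) that by blast
      then show "F i x < \<delta>" using closed_underD[OF \<delta>(1) x] by (rule less_trans)
    qed
    ultimately show False using F(2) by blast
  qed
  then obtain h where h: "\<And>\<epsilon>. \<epsilon> \<in> Q \<Longrightarrow> h \<epsilon> < \<theta> \<and> stat (S \<epsilon> (h \<epsilon>))" by metis
  have "\<exists>i<\<theta>. \<not> small {\<epsilon> \<in> Q. h \<epsilon> = i}"
    by (rule large_fibre) (use large h in blast)+
  then obtain i where i: "i < \<theta>" "\<not> small {\<epsilon> \<in> Q. h \<epsilon> = i}" by blast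
  define P where "P = {\<epsilon> \<in> Q. h \<epsilon> = i}"
  have P: "P \<subseteq> Q" "\<And>\<epsilon>. \<epsilon> \<in> P \<Longrightarrow> stat (S \<epsilon> i)" using h by (auto simp: P_def)
  obtain t where t: "inj_on t {..<\<theta>}" "t ` {..<\<theta>} \<subseteq> P"
    using i(2) not_small unfolding P_def by blast
  \<comment> \<open>At most one \<open>u\<close> qualifies, by disjointness. Points outside all the
    chosen sets get the default \<open>i\<close>, which is below \<theta>.\<close>
  define s where "s \<delta> = (if \<exists>u<\<theta>. \<delta> \<in> S (t u) i then SOME u. u < \<theta> \<and> \<delta> \<in> S (t u) i else i)" for \<delta>
  have "s \<delta> < \<theta>" for \<delta>
    using i(1) someI_ex[of "\<lambda>u. u < \<theta> \<and> \<delta> \<in> S (t u) i"] by (auto simp: s_def)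
  moreover have s_eq: "s \<delta> = u" if "u < \<theta>" "\<delta> \<in> S (t u) i" for \<delta> u
  proof -
    have "s \<delta> < \<theta> \<and> \<delta> \<in> S (t (s \<delta>)) i"
      using that someI_ex[of "\<lambda>u. u < \<theta> \<and> \<delta> \<in> S (t u) i"] by (auto simp: s_def)
    moreover have "t v \<in> Q" if "v < \<theta>" for v using t(2) P(1) that by blast
    ultimately have "t (s \<delta>) = t u"
      using that e(1)[of \<delta>] unfolding S_def by (auto dest!: inj_onD)
    then show ?thesis using t(1) that \<open>s \<delta> < \<theta> \<and> _\<close> by (auto dest: inj_onD)
  qed
  moreover have "stat {\<delta>. wide \<delta> \<and> s \<delta> = u}" if "u < \<theta>" for u
  proof -
    have "stat (S (t u) i)" using P(2) t(2) that by blast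
    moreover have "S (t u) i \<subseteq> {\<delta>. wide \<delta> \<and> s \<delta> = u}" using s_eq[OF that] by (auto simp: S_def)
    ultimately show ?thesis unfolding stat_def by blast
  qed
  ultimately show thesis using that by blast
qed

lemma onto_projections:
  obtains f where "\<And>\<xi> \<alpha> \<beta>. f \<xi> \<alpha> \<beta> < \<theta>"
    "\<And>Y. Y \<subseteq> Q \<Longrightarrow> \<not> small Y \<Longrightarrow> \<exists>\<xi>\<in>Q. \<exists>\<alpha>\<in>Q. f \<xi> \<alpha> ` Y = {..<\<theta>}"
proof -
  obtain e where e: "\<And>\<beta>. \<beta> \<in> Q \<Longrightarrow> inj_on (e \<beta>) {y \<in> Q. y \<le> \<beta>}"
    "\<And>\<beta> y. \<beta> \<in> Q \<Longrightarrow> y \<in> Q \<Longrightarrow> y \<le> \<beta> \<Longrightarrow> e \<beta> y < \<theta>"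
    using enumerations by blast
  obtain s where s: "\<And>\<delta>. s \<delta> < \<theta>" "\<And>t. t < \<theta> \<Longrightarrow> stat {\<delta>. wide \<delta> \<and> s \<delta> = t}"
    using stationary_partition by blast
  \<comment> \<open>All values of \<open>s\<close> are below \<theta>, so those of \<open>f\<close>
    are too, even where no such \<open>d\<close> exists.\<close>
  define f where "f \<xi> \<alpha> \<beta> = s (LEAST d. d \<in> Q \<and> \<alpha> < d \<and> d \<le> \<beta> \<and> e \<beta> d \<le> e \<beta> \<xi>)" for \<xi> \<alpha> \<beta>
  have "\<exists>\<xi>\<in>Q. \<exists>\<alpha>\<in>Q. f \<xi> \<alpha> ` Y = {..<\<theta>}" if Y: "Y \<subseteq> Q" "\<not> small Y" for Y
  proof (rule ccontr)
    assume "\<not> ?thesis"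
    moreover have "f \<xi> \<alpha> ` Y \<subseteq> {..<\<theta>}" for \<xi> \<alpha> using s(1) by (auto simp: f_def)
    ultimately have "\<forall>\<xi>\<in>Q. \<forall>\<alpha>\<in>Q. \<exists>i<\<theta>. i \<notin> f \<xi> \<alpha> ` Y" by blast
    then obtain m where m: "\<And>\<xi> \<alpha>. \<xi> \<in> Q \<Longrightarrow> \<alpha> \<in> Q \<Longrightarrow> m \<xi> \<alpha> < \<theta> \<and> m \<xi> \<alpha> \<notin> f \<xi> \<alpha> ` Y" by metis
    have "\<exists>i<\<theta>. \<not> small {\<alpha> \<in> Q. m \<xi> \<alpha> = i}" if "\<xi> \<in> Q" for \<xi>
      by (rule large_fibre) (use large m that in blast)+
    then obtain I where I: "\<And>\<xi>. \<xi> \<in> Q \<Longrightarrow> I \<xi> < \<theta> \<and> \<not> small {\<alpha> \<in> Q. m \<xi> \<alpha> = I \<xi>}" by metis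
    have "\<exists>i<\<theta>. \<not> small {\<xi> \<in> Q. I \<xi> = i}"
      by (rule large_fibre) (use large I in blast)+
    then obtain i where i: "i < \<theta>" "\<not> small {\<xi> \<in> Q. I \<xi> = i}" by blast
    have A: "\<exists>\<alpha>. \<alpha> \<in> Q \<and> m \<xi> \<alpha> = i \<and> x < \<alpha>" if "\<xi> \<in> Q" "I \<xi> = i" "x \<in> Q" for \<xi> x
      using unbounded[of "{\<alpha> \<in> Q. m \<xi> \<alpha> = i}" x] I that by auto
    define a where "a x \<xi> = (SOME \<alpha>. \<alpha> \<in> Q \<and> m \<xi> \<alpha> = i \<and> x < \<alpha>)" for x \<xi>
    have a: "a x \<xi> \<in> Q" "m \<xi> (a x \<xi>) = i" "x < a x \<xi>" if "\<xi> \<in> Q" "I \<xi> = i" "x \<in> Q" for x \<xi>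
      using someI_ex[OF A[OF that]] by (auto simp: a_def)
    \<comment> \<open>Closure of \<delta> under such bounds will make the \<xi> with
      \<open>I \<xi> = i\<close> unbounded below \<delta>, and keep \<open>a x \<xi>\<close> below
      \<delta> whenever \<open>\<xi> \<le> x\<close> and \<open>x < \<delta>\<close>.\<close>
    have "\<exists>z\<in>Q. (\<exists>\<xi>\<in>Q. I \<xi> = i \<and> x < \<xi> \<and> \<xi> < z) \<and> (\<forall>\<xi>\<in>Q. I \<xi> = i \<longrightarrow> \<xi> \<le> x \<longrightarrow> a x \<xi> < z)"
      if x: "x \<in> Q" for x
    proof -
      obtain \<xi> where \<xi>: "\<xi> \<in> Q" "I \<xi> = i" "x < \<xi>"
        using unbounded[of "{\<xi> \<in> Q. I \<xi> = i}" x] i x by auto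
      have "small {\<xi> \<in> Q. I \<xi> = i \<and> \<xi> \<le> x}" by (rule small_mono[OF initial_le[OF x]]) auto
      then have "small (insert \<xi> (a x ` {\<xi> \<in> Q. I \<xi> = i \<and> \<xi> \<le> x}))"
        by (intro small_insert small_image)
      moreover have "insert \<xi> (a x ` {\<xi> \<in> Q. I \<xi> = i \<and> \<xi> \<le> x}) \<subseteq> Q" using \<xi> a x by auto
      ultimately show ?thesis
        using bounded[of "insert \<xi> (a x ` {\<xi> \<in> Q. I \<xi> = i \<and> \<xi> \<le> x})"] \<xi> by (auto simp: Bex_def)
    qed
    then obtain F where F: "\<And>x. x \<in> Q \<Longrightarrow> F x \<in> Q \<and> (\<exists>\<xi>\<in>Q. I \<xi> = i \<and> x < \<xi> \<and> \<xi> < F x)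
        \<and> (\<forall>\<xi>\<in>Q. I \<xi> = i \<longrightarrow> \<xi> \<le> x \<longrightarrow> a x \<xi> < F x)" by metis
    then obtain \<delta> where \<delta>: "closed_under F \<delta>" "wide \<delta>" "s \<delta> = i"
      using s(2)[OF i(1)] unfolding stat_def by blast
    have \<delta>Q: "\<delta> \<in> Q" using \<delta>(1) by (simp add: closed_under_def)
    have F\<delta>: "F x < \<delta>" if "x \<in> Q" "x < \<delta>" for x using \<delta>(1) that by (simp add: closed_under_def)
    obtain \<beta> where \<beta>: "\<beta> \<in> Y" "\<delta> < \<beta>" using unbounded[OF Y \<delta>Q] by blast
    have \<beta>Q: "\<beta> \<in> Q" using \<beta> Y by blast
    have tiny: "tiny {y \<in> Q. y < \<delta> \<and> e \<beta> y \<le> j}" if "j < \<theta>" for j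
    proof -
      have "inj_on (e \<beta>) {y \<in> Q. y < \<delta> \<and> e \<beta> y \<le> j}"
        by (rule inj_on_subset[OF e(1)[OF \<beta>Q]]) (use \<beta> in auto)
      then have "|{y \<in> Q. y < \<delta> \<and> e \<beta> y \<le> j}| \<le>o |{..j}|"
        by (intro card_of_ordLeq[THEN iffD1] exI[of _ "e \<beta>"]) auto
      then show ?thesis by (rule ordLeq_ordLess_trans[OF _ below[OF that]])
    qed
    \<comment> \<open>If \<open>e \<beta> \<xi> < e \<beta> \<delta>\<close> held for all these
      \<xi>, they would form a tiny set, bounded below \<delta> because \<delta> is wide, although
      they are unbounded there.\<close>
    have "\<exists>\<xi>\<in>Q. I \<xi> = i \<and> \<xi> < \<delta> \<and> e \<beta> \<delta> \<le> e \<beta> \<xi>"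
    proof (rule ccontr)
      assume no: "\<not> ?thesis"
      have "e \<beta> \<delta> < \<theta>" using e(2)[OF \<beta>Q \<delta>Q] \<beta>(2) by simp
      then obtain b where b: "b \<in> Q" "b < \<delta>"
        "\<And>y. y \<in> {y \<in> Q. y < \<delta> \<and> e \<beta> y \<le> e \<beta> \<delta>} \<Longrightarrow> y < b"
        using wideD[OF \<delta>(2) _ tiny] by blast
      obtain \<xi> where "\<xi> \<in> Q" "I \<xi> = i" "b < \<xi>" "\<xi> < \<delta>" using F[OF b(1)] F\<delta>[OF b(1,2)] by force
      then show False using no b(3) by force
    qed
    then obtain \<xi> where \<xi>: "\<xi> \<in> Q" "I \<xi> = i" "\<xi> < \<delta>" "e \<beta> \<delta> \<le> e \<beta> \<xi>" by blast
    have "e \<beta> \<xi> < \<theta>" using e(2)[OF \<beta>Q \<xi>(1)] \<xi>(3) \<beta>(2) by simp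
    then obtain b where b: "b \<in> Q" "b < \<delta>"
      "\<And>y. y \<in> {y \<in> Q. y < \<delta> \<and> e \<beta> y \<le> e \<beta> \<xi>} \<Longrightarrow> y < b"
      using wideD[OF \<delta>(2) _ tiny] by blast
    \<comment> \<open>Exceeding \<open>b\<close> puts \<alpha> above every competitor of \<delta> in
      the \<open>LEAST\<close>; having \<open>\<xi> \<le> x\<close> is what lets \<open>F\<close>
      keep \<open>a x \<xi>\<close> below \<delta>.\<close>
    define x where "x = max b \<xi>"
    have x: "x \<in> Q" "x < \<delta>" "b \<le> x" "\<xi> \<le> x" using b \<xi> by (auto simp: x_def max_def)
    define \<alpha> where "\<alpha> = a x \<xi>"
    have \<alpha>: "\<alpha> \<in> Q" "m \<xi> \<alpha> = i" "x < \<alpha>" "\<alpha> < \<delta>"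
      using a[OF \<xi>(1,2) x(1)] F[OF x(1)] F\<delta>[OF x(1,2)] \<xi> x(4) by (auto simp: \<alpha>_def)
    have "(LEAST d. d \<in> Q \<and> \<alpha> < d \<and> d \<le> \<beta> \<and> e \<beta> d \<le> e \<beta> \<xi>) = \<delta>"
    proof (rule Least_equality)
      show "\<delta> \<in> Q \<and> \<alpha> < \<delta> \<and> \<delta> \<le> \<beta> \<and> e \<beta> \<delta> \<le> e \<beta> \<xi>" using \<delta>Q \<alpha> \<beta> \<xi> by simp
      fix d assume d: "d \<in> Q \<and> \<alpha> < d \<and> d \<le> \<beta> \<and> e \<beta> d \<le> e \<beta> \<xi>"
      show "\<delta> \<le> d"
      proof (rule ccontr)
        assume "\<not> \<delta> \<le> d"
        then have "d < b" using b(3) d by simp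
        also have "b < \<alpha>" using x(3) \<alpha>(3) by (rule le_less_trans)
        finally show False using d less_asym by blast
      qed
    qed
    then have "f \<xi> \<alpha> \<beta> = m \<xi> \<alpha>" using \<delta>(3) \<alpha>(2) by (simp only: f_def)
    then have "m \<xi> \<alpha> \<in> f \<xi> \<alpha> ` Y" using \<beta>(1) by (rule image_eqI[OF sym])
    then show False using m[OF \<xi>(1) \<alpha>(1)] by blast
  qed
  moreover have "f \<xi> \<alpha> \<beta> < \<theta>" for \<xi> \<alpha> \<beta> unfolding f_def by (rule s(1))
  ultimately show thesis by (intro that[of f])
qed

end

section \<open>Initial segments of infinite and regular cardinals\<close>

lemma Field_ord_on [simp]: "Field (ord_on X) = X"
  by (auto simp: ord_on_def Field_def)

lemma card_of_lessThan_cardinal: "infinite_cardinal \<theta> \<Longrightarrow> |{..<\<theta>}| =o ord_on {..<\<theta>}"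
  using card_of_Field_ordIso[of "ord_on {..<\<theta>}"] by (simp add: infinite_cardinal_def)

lemma card_of_lessThan_less:
  assumes "infinite_cardinal \<theta>" "j < \<theta>"
  shows "|{..<j}| <o |{..<\<theta>}|"
proof -
  have "underS (ord_on {..<\<theta>}) j = {..<j}" using assms(2) by (auto simp: underS_def ord_on_def)
  then have "|{..<j}| <o ord_on {..<\<theta>}"
    using card_of_underS[of "ord_on {..<\<theta>}" j] assms by (simp add: infinite_cardinal_def)
  then show ?thesis
    by (rule ordLess_ordIso_trans[OF _ ordIso_symmetric[OF card_of_lessThan_cardinal[OF assms(1)]]])
qed

lemma card_of_atMost_less:
  assumes "infinite_cardinal \<theta>" "j < \<theta>"
  shows "|{..j}| <o |{..<\<theta>}|"
proof -
  have inf: "infinite {..<\<theta>}" using assms(1) by (simp add: infinite_cardinal_def)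
  moreover have "{..j} = insert j {..<j}" by auto
  ultimately show ?thesis using card_of_insert_ordLess[OF _ card_of_lessThan_less[OF assms]] by simp
qed

lemma regular_UN_less:
  assumes "regular_cardinal \<theta>" "|I| <o |{..<\<theta>}|" "\<And>i. i \<in> I \<Longrightarrow> |A i| <o |{..<\<theta>}|"
  shows "|\<Union>i\<in>I. A i| <o |{..<\<theta>}|"
proof -
  have \<theta>: "infinite_cardinal \<theta>" "regularCard (ord_on {..<\<theta>})"
    using assms(1) by (auto simp: regular_cardinal_def)
  then have "stable (ord_on {..<\<theta>})" by (intro regularCard_stable) (auto simp: infinite_cardinal_def)
  then have "stable |{..<\<theta>}|"
    by (rule stable_ordIso1) (rule card_of_lessThan_cardinal[OF \<theta>(1)])
  then show ?thesis using assms(2,3) by (rule stable_UNION) auto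
qed

lemma infinite_cardinal_limit:
  assumes "infinite_cardinal \<theta>" "j < \<theta>"
  obtains k where "j < k" "k < \<theta>"
proof -
  have "\<not> {..<\<theta>} \<subseteq> {..j}"
    using card_of_atMost_less[OF assms] card_of_mono1 not_ordLess_ordLeq by blast
  then show thesis using that by (auto simp: subset_iff not_le)
qed

text \<open>One chain \<open>Q\<close> per \<rho> suffices: any other chain in the same \<rho>
  transfers to it by rounding up. Hence triples of ordinals that are at most \<mu> index all the
  maps.\<close>

lemma regular_projections:
  fixes \<theta> \<mu> :: "'a::wellorder"
  assumes "regular_cardinal \<theta>"
  obtains f :: "'a \<Rightarrow> 'a \<Rightarrow> 'a \<Rightarrow> 'a \<Rightarrow> 'a" where "\<And>\<rho> \<xi> \<alpha> \<tau>. f \<rho> \<xi> \<alpha> \<tau> < \<theta>"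
    "\<And>X. X \<subseteq> {..<\<mu>} \<Longrightarrow> \<not> |X| \<le>o |{..<\<theta>}| \<Longrightarrow>
      \<exists>\<rho>\<le>\<mu>. \<exists>\<xi><\<mu>. \<exists>\<alpha><\<mu>. {..<\<theta>} \<subseteq> f \<rho> \<xi> \<alpha> ` X"
proof -
  have \<theta>: "infinite_cardinal \<theta>" using assms by (simp add: regular_cardinal_def)
  then have inf: "infinite {..<\<theta>}" by (simp add: infinite_cardinal_def)
  \<comment> \<open>Such an \<open>X\<close> has order type \<open>\<theta>\<^sup>+\<close> and is
    cofinal in \<rho>.\<close>
  define chain where "chain \<rho> X \<longleftrightarrow> X \<subseteq> {..<\<rho>} \<and> \<not> |X| \<le>o |{..<\<theta>}| \<and>
    (\<forall>x<\<rho>. |{y \<in> X. y < x}| \<le>o |{..<\<theta>}| )" for \<rho> and X :: "'a set"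
  define good where "good \<rho> g \<longleftrightarrow> (\<forall>\<xi> \<alpha> \<tau>. g \<xi> \<alpha> \<tau> < \<theta>) \<and>
    (\<forall>X. chain \<rho> X \<longrightarrow> (\<exists>\<xi><\<rho>. \<exists>\<alpha><\<rho>. g \<xi> \<alpha> ` X = {..<\<theta>}))" for \<rho> and g :: "'a \<Rightarrow> 'a \<Rightarrow> 'a \<Rightarrow> 'a"
  have "\<exists>g. good \<rho> g" for \<rho>
  proof (cases "\<exists>X. chain \<rho> X")
    case False
    \<comment> \<open>Vacuous case: any constant below \<theta> is good.\<close>
    obtain j where "j < \<theta>" using inf by (metis finite.emptyI lessThan_iff subsetI subset_empty)
    then have "good \<rho> (\<lambda>_ _ _. j)" using False by (simp add: good_def)
    then show ?thesis by blast
  next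
    case True
    then obtain Q where Q: "chain \<rho> Q" by blast
    interpret successor_chain Q \<theta>
    proof
      show "|{..j}| <o |{..<\<theta>}|" if "j < \<theta>" for j using card_of_atMost_less[OF \<theta> that] .
      show "|{y \<in> Q. y < x}| \<le>o |{..<\<theta>}|" if "x \<in> Q" for x using Q that by (auto simp: chain_def)
    qed (use inf Q regular_UN_less[OF assms] in \<open>auto simp: chain_def\<close>)
    obtain f where f: "\<And>\<xi> \<alpha> \<beta>. f \<xi> \<alpha> \<beta> < \<theta>"
      "\<And>Y. Y \<subseteq> Q \<Longrightarrow> \<not> small Y \<Longrightarrow> \<exists>\<xi>\<in>Q. \<exists>\<alpha>\<in>Q. f \<xi> \<alpha> ` Y = {..<\<theta>}"
      using onto_projections by blast
    \<comment> \<open>Rounding up to the next point of \<open>Q\<close>, which exists by cofinality.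
      A bound in \<open>Q\<close> for the image of \<open>X\<close> would bound \<open>X\<close>
      below \<rho>, so the image stays large.\<close>
    define h where "h \<tau> = (LEAST q. q \<in> Q \<and> \<tau> \<le> q)" for \<tau>
    have h: "h \<tau> \<in> Q" "\<tau> \<le> h \<tau>" if "\<tau> < \<rho>" for \<tau>
    proof -
      have "\<not> Q \<subseteq> {y \<in> Q. y < \<tau>}" using Q that small_mono unfolding chain_def by blast
      then have "\<exists>q. q \<in> Q \<and> \<tau> \<le> q" by (auto simp: not_less)
      from LeastI_ex[OF this] show "h \<tau> \<in> Q" "\<tau> \<le> h \<tau>" by (auto simp: h_def)
    qed
    have "\<exists>\<xi><\<rho>. \<exists>\<alpha><\<rho>. (\<lambda>\<tau>. f \<xi> \<alpha> (h \<tau>)) ` X = {..<\<theta>}" if X: "chain \<rho> X" for X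
    proof -
      have sub: "h ` X \<subseteq> Q" using X h by (auto simp: chain_def)
      have "\<not> small (h ` X)"
      proof
        assume "small (h ` X)"
        then obtain q where q: "q \<in> Q" "\<forall>w\<in>h ` X. w < q" using bounded[OF sub] by blast
        have "\<tau> < q" if "\<tau> \<in> X" for \<tau>
          using q(2) h(2)[of \<tau>] that X by (force simp: chain_def)
        then have "X \<subseteq> {y \<in> X. y < q}" by blast
        moreover have "small {y \<in> X. y < q}" using X Q q(1) by (auto simp: chain_def)
        ultimately show False using X small_mono unfolding chain_def by blast
      qed
      then obtain \<xi> \<alpha> where "\<xi> \<in> Q" "\<alpha> \<in> Q" "f \<xi> \<alpha> ` h ` X = {..<\<theta>}" using f(2)[OF sub] by blast
      then show ?thesis using Q unfolding chain_def image_image by blast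
    qed
    then have "good \<rho> (\<lambda>\<xi> \<alpha> \<tau>. f \<xi> \<alpha> (h \<tau>))" using f(1) by (simp add: good_def)
    then show ?thesis by blast
  qed
  then obtain f where f: "\<And>\<rho>. good \<rho> (f \<rho>)" by metis
  have "\<exists>\<rho>\<le>\<mu>. \<exists>\<xi><\<mu>. \<exists>\<alpha><\<mu>. {..<\<theta>} \<subseteq> f \<rho> \<xi> \<alpha> ` X"
    if X: "X \<subseteq> {..<\<mu>}" "\<not> |X| \<le>o |{..<\<theta>}|" for X
  proof -
    have "{y \<in> X. y < \<mu>} = X" using X(1) by auto
    then have ex: "\<not> |{y \<in> X. y < \<mu>}| \<le>o |{..<\<theta>}|" using X(2) by simp
    define \<rho> where "\<rho> = (LEAST x. \<not> |{y \<in> X. y < x}| \<le>o |{..<\<theta>}| )"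
    have \<rho>: "\<not> |{y \<in> X. y < \<rho>}| \<le>o |{..<\<theta>}|" unfolding \<rho>_def by (rule LeastI, rule ex)
    \<comment> \<open>Equality does occur, for instance when \<mu> is
      \<open>\<theta>\<^sup>+\<close>.\<close>
    have "\<rho> \<le> \<mu>" unfolding \<rho>_def by (rule Least_le, rule ex)
    have "|{y \<in> X. y < x}| \<le>o |{..<\<theta>}|" if "x < \<rho>" for x
      using not_less_Least[OF that[unfolded \<rho>_def]] by simp
    moreover have "{y \<in> {y \<in> X. y < \<rho>}. y < x} = {y \<in> X. y < x}" if "x < \<rho>" for x
      using that by auto
    ultimately have "chain \<rho> {y \<in> X. y < \<rho>}" using \<rho> by (auto simp: chain_def)
    then obtain \<xi> \<alpha> where "\<xi> < \<rho>" "\<alpha> < \<rho>" "f \<rho> \<xi> \<alpha> ` {y \<in> X. y < \<rho>} = {..<\<theta>}"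
      using f unfolding good_def by blast
    moreover have "f \<rho> \<xi> \<alpha> ` {y \<in> X. y < \<rho>} \<subseteq> f \<rho> \<xi> \<alpha> ` X" by blast
    ultimately show ?thesis using \<open>\<rho> \<le> \<mu>\<close> by (metis less_le_trans)
  qed
  moreover have "f \<rho> \<xi> \<alpha> \<tau> < \<theta>" for \<rho> \<xi> \<alpha> \<tau> using f by (simp add: good_def)
  ultimately show thesis using that by blast
qed

section \<open>Subnormal ideals: completeness and positive colours\<close>

locale subnormal_ideal =
  fixes \<kappa> :: "'a::wellorder" and J :: "'a set set"
  assumes regular: "regular_cardinal \<kappa>"
    and ideal: "ideal_over \<kappa> J"
    and subnormal: "subnormal \<kappa> J"
    and bounded_null: "bounded_ideal \<kappa> \<subseteq> J"
begin

lemma kappa: "infinite_cardinal \<kappa>"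
  using regular by (simp add: regular_cardinal_def)

lemma null_subset: "A \<in> J \<Longrightarrow> B \<subseteq> A \<Longrightarrow> B \<in> J"
  using ideal by (auto simp: ideal_over_def)

lemma positive_unbounded:
  assumes "A \<in> positive \<kappa> J" "\<gamma> < \<kappa>"
  shows "\<exists>\<beta>\<in>A. \<gamma> < \<beta>"
proof (rule ccontr)
  assume "\<not> ?thesis"
  moreover obtain k where "\<gamma> < k" "k < \<kappa>" using infinite_cardinal_limit[OF kappa assms(2)] .
  ultimately have "A \<in> bounded_ideal \<kappa>"
    using assms(1) by (force simp: bounded_ideal_def positive_def not_less)
  then show False using assms(1) bounded_null by (auto simp: positive_def)
qed

text \<open>The first clause of subnormality, phrased with the null complements
  \<open>N \<eta>\<close> of the sets in the dual filter.\<close>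

lemma diagonal_avoidance:
  assumes N: "\<And>\<eta>. \<eta> < \<kappa> \<Longrightarrow> N \<eta> \<in> J" and B: "B \<in> positive \<kappa> J"
  obtains B' where "B' \<in> positive \<kappa> J" "B' \<subseteq> B"
    "\<And>\<eta> \<beta>. \<eta> \<in> B' \<Longrightarrow> \<beta> \<in> B' \<Longrightarrow> \<eta> < \<beta> \<Longrightarrow> \<beta> \<notin> N \<eta>"
proof -
  have "\<forall>\<eta><\<kappa>. {..<\<kappa>} - N \<eta> \<in> dual_filter \<kappa> J" using N by (auto simp: dual_filter_def)
  then have "\<exists>B' \<in> positive \<kappa> J. B' \<subseteq> B \<and>
      (\<forall>\<eta>\<in>B'. \<forall>\<beta>\<in>B'. \<eta> < \<beta> \<longrightarrow> \<beta> \<in> {..<\<kappa>} - N \<eta>)"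
    using subnormal[unfolded subnormal_def, rule_format, of "\<lambda>\<eta>. {..<\<kappa>} - N \<eta>"] B by simp
  then show thesis using that by blast
qed

lemma positive_fibre:
  assumes B: "B \<in> positive \<kappa> J" and f: "f ` B \<subseteq> Y" and Y: "|Y| <o |{..<\<kappa>}|"
  shows "\<exists>y\<in>Y. {\<beta> \<in> B. f \<beta> = y} \<in> positive \<kappa> J"
proof (rule ccontr)
  assume "\<not> ?thesis"
  then have fib: "{\<beta> \<in> B. f \<beta> = y} \<in> J" if "y \<in> Y" for y
    using that B by (auto simp: positive_def)
  have "{} \<in> J" using ideal by (simp add: ideal_over_def)
  \<comment> \<open>Avoiding the fibre through each earlier point makes \<open>f\<close> injective on a positive set.\<close>
  then have "{\<beta> \<in> B. \<eta> \<in> B \<and> f \<beta> = f \<eta>} \<in> J" for \<eta>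
    using fib[of "f \<eta>"] f by (cases "\<eta> \<in> B") auto
  then obtain B' where B': "B' \<in> positive \<kappa> J" "B' \<subseteq> B"
    "\<And>\<eta> \<beta>. \<eta> \<in> B' \<Longrightarrow> \<beta> \<in> B' \<Longrightarrow> \<eta> < \<beta> \<Longrightarrow> \<beta> \<notin> {\<beta> \<in> B. \<eta> \<in> B \<and> f \<beta> = f \<eta>}"
    using diagonal_avoidance[OF _ B, of "\<lambda>\<eta>. {\<beta> \<in> B. \<eta> \<in> B \<and> f \<beta> = f \<eta>}"] by blast
  have "inj_on f B'"
  proof (rule linorder_inj_onI')
    fix \<eta> \<beta> assume "\<eta> \<in> B'" "\<beta> \<in> B'" "\<eta> < \<beta>"
    then show "f \<eta> \<noteq> f \<beta>" using B'(2) B'(3)[of \<eta> \<beta>] by auto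
  qed
  \<comment> \<open>The injection gives \<open>B'\<close> fewer than \<kappa> elements, while as a
    positive set it is unbounded in the regular \<kappa>.\<close>
  then have "|B'| \<le>o |Y|" using B'(2) f by (intro card_of_ordLeq[THEN iffD1]) blast
  then have "|B'| <o |{..<\<kappa>}|" using Y by (rule ordLeq_ordLess_trans)
  then have "|\<Union>b\<in>B'. {..<b}| <o |{..<\<kappa>}|"
    using B'(1) card_of_lessThan_less[OF kappa] by (intro regular_UN_less[OF regular]) (auto simp: positive_def)
  moreover have "{..<\<kappa>} \<subseteq> (\<Union>b\<in>B'. {..<b})" using positive_unbounded[OF B'(1)] by auto
  ultimately show False using card_of_mono1 not_ordLess_ordLeq by blast
qed

text \<open>If the union were positive, the map choosing for each point the index of a null set
  containing it would have a positive fibre, inside that one null set.\<close>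

lemma null_UN:
  assumes I: "|I| <o |{..<\<kappa>}|" and N: "\<And>i. i \<in> I \<Longrightarrow> N i \<in> J"
  shows "(\<Union>i\<in>I. N i) \<in> J"
proof (rule ccontr)
  assume "\<not> ?thesis"
  moreover have "N i \<subseteq> {..<\<kappa>}" if "i \<in> I" for i using N[OF that] ideal by (auto simp: ideal_over_def)
  ultimately have U: "(\<Union>i\<in>I. N i) \<in> positive \<kappa> J" by (auto simp: positive_def)
  have "\<forall>\<beta>\<in>(\<Union>i\<in>I. N i). \<exists>i. i \<in> I \<and> \<beta> \<in> N i" by blast
  then obtain f where f: "\<forall>\<beta>\<in>(\<Union>i\<in>I. N i). f \<beta> \<in> I \<and> \<beta> \<in> N (f \<beta>)"
    by (rule bchoice[THEN exE])
  then obtain i where i: "i \<in> I" "{\<beta> \<in> (\<Union>i\<in>I. N i). f \<beta> = i} \<in> positive \<kappa> J"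
    using positive_fibre[OF U _ I, of f] by blast
  have "{\<beta> \<in> (\<Union>i\<in>I. N i). f \<beta> = i} \<subseteq> N i" using f by blast
  from null_subset[OF N[OF i(1)] this] show False using i(2) unfolding positive_def by blast
qed

text \<open>\<open>N \<eta>\<close> collects the points whose colour has a null fibre; it is null,
  since fewer than \<kappa> colours occur. On a positive \<open>B'\<close> avoiding these sets, all
  colours at \<xi> but one come from \<open>X \<xi>\<close>, so \<open>many\<close> for
  \<open>B'\<close> makes \<open>X \<xi>\<close> large.\<close>

lemma positive_colours:
  assumes inf: "infinite T" and c: "c ` pairs \<kappa> \<subseteq> Y" and Y: "|Y| <o |{..<\<kappa>}|"
    and many: "\<And>B. B \<in> positive \<kappa> J \<Longrightarrow> \<exists>\<eta><\<kappa>. \<not> |c ` ({\<eta>} \<circledast> B)| \<le>o |T|"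
    and B: "B \<in> positive \<kappa> J"
  shows "\<exists>\<eta><\<kappa>. \<not> |{\<tau>. {\<beta> \<in> B. \<eta> < \<beta> \<and> c (\<eta>, \<beta>) = \<tau>} \<in> positive \<kappa> J}| \<le>o |T|"
proof (rule ccontr)
  define X where "X \<eta> = {\<tau>. {\<beta> \<in> B. \<eta> < \<beta> \<and> c (\<eta>, \<beta>) = \<tau>} \<in> positive \<kappa> J}" for \<eta>
  define N where "N \<eta> = {\<beta> \<in> B. \<eta> < \<beta> \<and> c (\<eta>, \<beta>) \<notin> X \<eta>}" for \<eta>
  assume "\<not> ?thesis"
  then have X: "|X \<eta>| \<le>o |T|" if "\<eta> < \<kappa>" for \<eta> using that by (auto simp: X_def)
  have B\<kappa>: "B \<subseteq> {..<\<kappa>}" using B by (auto simp: positive_def)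
  have "N \<eta> \<in> J" for \<eta>
  proof (rule ccontr)
    assume "N \<eta> \<notin> J"
    then have pos: "N \<eta> \<in> positive \<kappa> J" using B\<kappa> by (auto simp: N_def positive_def)
    have "(\<lambda>\<beta>. c (\<eta>, \<beta>)) ` N \<eta> \<subseteq> Y" using c B\<kappa> by (auto simp: N_def pairs_def)
    then obtain \<tau> where \<tau>: "{\<beta> \<in> N \<eta>. c (\<eta>, \<beta>) = \<tau>} \<in> positive \<kappa> J"
      using positive_fibre[OF pos _ Y] by blast
    moreover have "{\<beta> \<in> N \<eta>. c (\<eta>, \<beta>) = \<tau>} \<subseteq> {\<beta> \<in> B. \<eta> < \<beta> \<and> c (\<eta>, \<beta>) = \<tau>}"
      by (auto simp: N_def)
    ultimately have "\<tau> \<in> X \<eta>" using null_subset B\<kappa> by (auto simp: X_def positive_def)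
    then have empty: "{\<beta> \<in> N \<eta>. c (\<eta>, \<beta>) = \<tau>} = {}" by (auto simp: N_def)
    show False using \<tau> ideal unfolding empty by (simp add: positive_def ideal_over_def)
  qed
  \<comment> \<open>Avoiding \<open>N \<xi>\<close> for all \<open>\<xi> \<le> \<eta>\<close>, not only \<open>N \<eta>\<close>, also handles those \<open>\<xi>\<close> outside \<open>B'\<close>.\<close>
  then have "(\<Union>\<xi>\<in>{..\<eta>}. N \<xi>) \<in> J" if "\<eta> < \<kappa>" for \<eta>
    using null_UN card_of_atMost_less[OF kappa that] by blast
  then obtain B' where B': "B' \<in> positive \<kappa> J" "B' \<subseteq> B"
    "\<And>\<eta> \<beta>. \<eta> \<in> B' \<Longrightarrow> \<beta> \<in> B' \<Longrightarrow> \<eta> < \<beta> \<Longrightarrow> \<beta> \<notin> (\<Union>\<xi>\<in>{..\<eta>}. N \<xi>)"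
    using diagonal_avoidance[OF _ B, of "\<lambda>\<eta>. \<Union>\<xi>\<in>{..\<eta>}. N \<xi>"] by blast
  obtain \<xi> where \<xi>: "\<xi> < \<kappa>" "\<not> |c ` ({\<xi>} \<circledast> B')| \<le>o |T|" using many[OF B'(1)] by blast
  have ex: "\<exists>\<eta>. \<eta> \<in> B' \<and> \<xi> < \<eta>" using positive_unbounded[OF B'(1) \<xi>(1)] by blast
  \<comment> \<open>Avoidance speaks of pairs from \<open>B'\<close>, so the first element of
    \<open>B'\<close> above \<xi> stands in for \<xi>. Its own colour is not controlled, hence the
    \<open>insert\<close>.\<close>
  define \<eta> where "\<eta> = (LEAST \<eta>. \<eta> \<in> B' \<and> \<xi> < \<eta>)"
  have \<eta>: "\<eta> \<in> B'" "\<xi> < \<eta>" using LeastI_ex[OF ex] by (auto simp: \<eta>_def)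
  have "c (\<xi>, \<beta>) \<in> insert (c (\<xi>, \<eta>)) (X \<xi>)" if \<beta>: "\<beta> \<in> B'" "\<xi> < \<beta>" for \<beta>
  proof (cases "\<beta> = \<eta>")
    case False
    have "\<eta> \<le> \<beta>" unfolding \<eta>_def by (rule Least_le) (use \<beta> in simp)
    then have "\<beta> \<notin> N \<xi>" using B'(3)[of \<eta> \<beta>] \<eta> \<beta> False by auto
    then show ?thesis using \<beta> B'(2) by (auto simp: N_def)
  qed simp
  then have "c ` ({\<xi>} \<circledast> B') \<subseteq> insert (c (\<xi>, \<eta>)) (X \<xi>)" by (auto simp: circledast_def)
  then have "|c ` ({\<xi>} \<circledast> B')| \<le>o |insert (c (\<xi>, \<eta>)) (X \<xi>)|" by (rule card_of_mono1)
  moreover have "|insert (c (\<xi>, \<eta>)) (X \<xi>)| \<le>o |T|" by (rule card_of_insert_ordLeq[OF inf X[OF \<xi>(1)]])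
  ultimately show False using \<xi>(2) by (metis ordLeq_transitive)
qed

end

section \<open>Composing the colouring with the projections\<close>

theorem theorem6p8:
  fixes \<theta> \<mu> \<kappa> :: "'a::wellorder" and J :: "'a set set"
  assumes "regular_cardinal \<theta>" and "infinite_cardinal \<mu>" and "regular_cardinal \<kappa>"
    and "\<theta> < \<mu>" and "\<mu> < \<kappa>"
    and "ideal_over \<kappa> J" and "subnormal \<kappa> J" and "bounded_ideal \<kappa> \<subseteq> J"
    and "ubd \<kappa> J \<mu>"
  shows "onto \<kappa> J \<theta>"
proof -
  interpret subnormal_ideal \<kappa> J using assms by unfold_locales
  have inf: "infinite {..<\<theta>}" "infinite {..<\<kappa>}"
    using assms(1,3) by (auto simp: regular_cardinal_def infinite_cardinal_def)
  obtain c where c: "c ` pairs \<kappa> \<subseteq> {..<\<mu>}"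
    "\<And>B. B \<in> positive \<kappa> J \<Longrightarrow> \<exists>\<eta><\<kappa>. has_otp (c ` ({\<eta>} \<circledast> B)) \<mu>"
    using assms(9) by (auto simp: ubd_def)
  have otp: "\<not> |X| \<le>o |{..<\<theta>}|" if "has_otp X \<mu>" for X
  proof
    assume "|X| \<le>o |{..<\<theta>}|"
    moreover have "|{..<\<mu>}| =o |X|"
      using card_of_cong[OF that[unfolded has_otp_def]] by (simp add: ordIso_symmetric)
    ultimately have "|{..<\<mu>}| \<le>o |{..<\<theta>}|" by (rule ordIso_ordLeq_trans[rotated])
    then show False using card_of_lessThan_less[OF assms(2,4)] not_ordLess_ordLeq by blast
  qed
  obtain f where f: "\<And>\<rho> \<xi> \<alpha> \<tau>. f \<rho> \<xi> \<alpha> \<tau> < \<theta>"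
    "\<And>X. X \<subseteq> {..<\<mu>} \<Longrightarrow> \<not> |X| \<le>o |{..<\<theta>}| \<Longrightarrow>
      \<exists>\<rho>\<le>\<mu>. \<exists>\<xi><\<mu>. \<exists>\<alpha><\<mu>. {..<\<theta>} \<subseteq> f \<rho> \<xi> \<alpha> ` X"
    using regular_projections[OF assms(1), of \<mu>] by blast
  \<comment> \<open>The coordinates are the \<eta> at which \<open>c\<close> is read and the three
    indices of a projection. As \<open>K\<close> has at most \<kappa> elements, a single \<zeta>
    below \<kappa> can code all four.\<close>
  define K where "K = {..<\<kappa>} \<times> {..<\<kappa>} \<times> {..<\<kappa>} \<times> {..<\<kappa>}"
  have times: "|A \<times> B| \<le>o |{..<\<kappa>}|" if "|A| \<le>o |{..<\<kappa>}|" "|B| \<le>o |{..<\<kappa>}|"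
    for A :: "'a set" and B :: "'b set"
    by (rule card_of_Times_ordLeq_infinite_Field)
      (use that inf(2) card_of_Card_order[of "{..<\<kappa>}"] in \<open>simp_all add: Field_card_of\<close>)
  have "|K| \<le>o |{..<\<kappa>}|"
    unfolding K_def by (intro times ordIso_imp_ordLeq[OF card_of_refl])
  moreover have "K \<noteq> {}" using inf(2) by (auto simp: K_def)
  ultimately obtain code where code: "code ` {..<\<kappa>} = K" by (metis card_of_ordLeq2)
  define d where "d = (\<lambda>(\<zeta>, \<beta>). case code \<zeta> of (\<eta>, \<rho>, \<xi>, \<alpha>) \<Rightarrow> f \<rho> \<xi> \<alpha> (c (\<eta>, \<beta>)))"
  have d: "d p < \<theta>" for p using f(1) by (simp add: d_def split: prod.split)
  have "\<exists>\<zeta><\<kappa>. d ` ({\<zeta>} \<circledast> B) = {..<\<theta>}" if B: "B \<in> positive \<kappa> J" for B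
  proof -
    obtain \<eta> where \<eta>: "\<eta> < \<kappa>"
      "\<not> |{\<tau>. {\<beta> \<in> B. \<eta> < \<beta> \<and> c (\<eta>, \<beta>) = \<tau>} \<in> positive \<kappa> J}| \<le>o |{..<\<theta>}|"
      using positive_colours[OF inf(1) c(1) card_of_lessThan_less[OF kappa assms(5)] _ B] c(2) otp by blast
    define X where "X = {\<tau>. {\<beta> \<in> B. \<eta> < \<beta> \<and> c (\<eta>, \<beta>) = \<tau>} \<in> positive \<kappa> J}"
    \<comment> \<open>The code \<zeta> may exceed \<eta>, so each colour must recur at some \<beta>
      above \<zeta>; positive fibres are unbounded and provide it.\<close>
    have mem: "\<exists>\<beta>\<in>B. \<zeta> < \<beta> \<and> \<eta> < \<beta> \<and> c (\<eta>, \<beta>) = \<tau>" if "\<tau> \<in> X" "\<zeta> < \<kappa>" for \<tau> \<zeta>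
      using positive_unbounded[of "{\<beta> \<in> B. \<eta> < \<beta> \<and> c (\<eta>, \<beta>) = \<tau>}" \<zeta>] that by (auto simp: X_def)
    have "X \<subseteq> {..<\<mu>}"
    proof
      fix \<tau> assume "\<tau> \<in> X"
      then obtain \<beta> where "\<beta> \<in> B" "\<eta> < \<beta>" "c (\<eta>, \<beta>) = \<tau>" using mem[OF _ \<eta>(1)] by blast
      moreover have "\<beta> < \<kappa>" using \<open>\<beta> \<in> B\<close> B by (auto simp: positive_def)
      ultimately show "\<tau> \<in> {..<\<mu>}" using c(1) by (auto simp: pairs_def)
    qed
    then obtain \<rho> \<xi> \<alpha> where *: "\<rho> \<le> \<mu>" "\<xi> < \<mu>" "\<alpha> < \<mu>" "{..<\<theta>} \<subseteq> f \<rho> \<xi> \<alpha> ` X"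
      using f(2) \<eta>(2) unfolding X_def by blast
    then have "(\<eta>, \<rho>, \<xi>, \<alpha>) \<in> K" using \<eta>(1) assms(5) by (auto simp: K_def)
    then obtain \<zeta> where \<zeta>: "\<zeta> < \<kappa>" "code \<zeta> = (\<eta>, \<rho>, \<xi>, \<alpha>)" using code by (metis imageE lessThan_iff)
    have "i \<in> d ` ({\<zeta>} \<circledast> B)" if i: "i < \<theta>" for i
    proof -
      obtain \<tau> where \<tau>: "\<tau> \<in> X" "i = f \<rho> \<xi> \<alpha> \<tau>" using *(4) i by blast
      then obtain \<beta> where \<beta>: "\<beta> \<in> B" "\<zeta> < \<beta>" "c (\<eta>, \<beta>) = \<tau>" using mem[OF _ \<zeta>(1)] by blast
      then have "d (\<zeta>, \<beta>) = i" using \<zeta>(2) \<tau>(2) by (simp add: d_def)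
      moreover have "(\<zeta>, \<beta>) \<in> {\<zeta>} \<circledast> B" using \<beta> by (simp add: circledast_def)
      ultimately show ?thesis by blast
    qed
    then show ?thesis using \<zeta>(1) d by blast
  qed
  moreover have "d ` pairs \<kappa> \<subseteq> {..<\<theta>}" using d by auto
  ultimately show ?thesis unfolding onto_def by blast
qed

end
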